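(* The maximal cardinality of a positively linearly independent set in $\mathbb{R}^1$ is $2$. That is, every positively linearly independent set $\mathcal{V} = \{v^1, \ldots, v^m\} \subseteq \mathbb{R}^1$ has $|\mathcal{V}| \leq 2$, and there exists a positively linearly independent set in $\mathbb{R}^1$ with exactly $2$ elements.
   Context: For a finite set of vectors $\mathcal{V} = \{v^1, v^2, \ldots, v^m\} \subseteq \mathbb{R}^n$ (distinct vectors), the positive span of $\mathcal{V}$ is $\text{p-span}(\mathcal{V}) = \left\{\sum_{i=1}^m \alpha_i v^i : \alpha_i \geq 0 \text{ for all } i = 1, \ldots, m\right\}$. The set $\mathcal{V}$ is positively linearly independent if $v^i \notin \text{p-span}(\mathcal{V} \setminus \{v^i\})$ for all $i = 1, \ldots, m$. By convention any set consisting of exactly one vector (including $\{0\}$) is positively linearly independent, i.e. the positive span of the empty set is taken to be empty. *)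

theory Defs
  imports "HOL-Analysis.Analysis"
begin

text \<open>
  The positive span is meant for finite sets only. The positive span of the empty set is taken
  to be empty (the empty sum would give \<open>{0}\<close>), so that every singleton, including \<open>{0}\<close>,
  is positively linearly independent.
\<close>

definition pspan :: "'a::real_vector set \<Rightarrow> 'a set" where
  "pspan V = (if V = {} then {} else {\<Sum>v\<in>V. \<alpha> v *\<^sub>R v | \<alpha>. \<forall>v\<in>V. 0 \<le> \<alpha> v})"

definition pos_lin_indep :: "'a::real_vector set \<Rightarrow> bool" where
  "pos_lin_indep V \<longleftrightarrow> finite V \<and> (\<forall>v\<in>V. v \<notin> pspan (V - {v}))"

end

theory Submission
  imports Defs
begin

text \<open>
  Of two distinct elements of a positively independent subset of the line, neither is a
  nonnegative multiple of the other, so they have strictly opposite signs; three real numbers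
  cannot have pairwise strictly opposite signs.
\<close>

lemma scaleR_in_pspan:
  assumes "finite W" "w \<in> W" "0 \<le> c"
  shows "c *\<^sub>R w \<in> pspan W"
proof -
  \<comment> \<open>The coefficient family is \<open>c\<close> at \<open>w\<close> and 0 elsewhere.
    Since \<open>w \<in> W\<close>, the special value of \<open>pspan\<close> at the empty set does
    not arise.\<close>
  have "(\<Sum>v\<in>W. (if v = w then c else 0) *\<^sub>R v) = (\<Sum>v\<in>W. if v = w then c *\<^sub>R v else 0)"
    by (rule sum.cong) auto
  also have "\<dots> = c *\<^sub>R w"
    using assms by simp
  finally have "c *\<^sub>R w = (\<Sum>v\<in>W. (if v = w then c else 0) *\<^sub>R v)" ..
  moreover have "\<forall>v\<in>W. 0 \<le> (if v = w then c else 0)"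
    using assms by simp
  ultimately show ?thesis
    using assms unfolding pspan_def by auto
qed

lemma pos_lin_indep_neq_scaleR:
  assumes "pos_lin_indep V" "v \<in> V" "w \<in> V" "v \<noteq> w" "0 \<le> c"
  shows "v \<noteq> c *\<^sub>R w"
  using assms scaleR_in_pspan[of "V - {v}" w c] by (auto simp: pos_lin_indep_def)

lemma pos_lin_indep_opposite_signs:
  fixes V :: "(real ^ 1) set"
  assumes V: "pos_lin_indep V" "v \<in> V" "w \<in> V" "v \<noteq> w"
  shows "v $ 1 * w $ 1 < 0"
proof (rule ccontr)
  assume nonneg: "\<not> v $ 1 * w $ 1 < 0"
  \<comment> \<open>The multiplier 0 suffices here: the zero vector is
    \<open>0 *\<^sub>R v\<close>.\<close>
  have "w \<noteq> 0"
    using pos_lin_indep_neq_scaleR[of V w v 0] V by auto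
  then have "w $ 1 \<noteq> 0"
    by (simp add: vec_eq_iff)
  \<comment> \<open>In dimension one, the ratio of the only coordinates is the multiplier; it has
    the sign of their product.\<close>
  then have "v = (v $ 1 / w $ 1) *\<^sub>R w"
    by (simp add: vec_eq_iff)
  moreover have "0 \<le> v $ 1 / w $ 1"
    using nonneg by (simp add: zero_le_divide_iff zero_le_mult_iff not_less)
  ultimately show False
    using pos_lin_indep_neq_scaleR[OF V] by blast
qed

lemma pos_lin_indep_card_le_2:
  fixes V :: "(real ^ 1) set"
  assumes "pos_lin_indep V"
  shows "card V \<le> 2"
proof (rule ccontr)
  assume "\<not> card V \<le> 2"
  then obtain T where "T \<subseteq> V" "card T = 3"
    using obtain_subset_with_card_n[of 3 V] by (metis not_less_eq_eq numeral_2_eq_2 numeral_3_eq_3)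
  then obtain a b c where "a \<in> V" "b \<in> V" "c \<in> V" "a \<noteq> b" "b \<noteq> c" "a \<noteq> c"
    by (auto simp: card_3_iff)
  then have "a $ 1 * b $ 1 < 0" "b $ 1 * c $ 1 < 0" "a $ 1 * c $ 1 < 0"
    using pos_lin_indep_opposite_signs[OF assms] by blast+
  then show False
    by (auto simp: mult_less_0_iff)
qed

lemma pos_lin_indep_1_minus_1: "pos_lin_indep {1, -1 :: real ^ 1}"
proof -
  \<comment> \<open>Each of the two spans is a closed half-line starting at 0, and the other vector
    lies strictly on the opposite side.\<close>
  have "(1 :: real ^ 1) \<notin> pspan {-1}" "(-1 :: real ^ 1) \<notin> pspan {1}"
    by (auto simp: pspan_def vec_eq_iff)
  \<comment> \<open>Distinctness ensures that deleting one vector leaves exactly the other.\<close>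
  moreover have "(1 :: real ^ 1) \<noteq> -1"
    by (simp add: vec_eq_iff)
  ultimately show ?thesis
    by (simp add: pos_lin_indep_def insert_Diff_if)
qed

theorem proposition2:
  shows "(\<forall>V :: (real ^ 1) set. pos_lin_indep V \<longrightarrow> card V \<le> 2) \<and>
         (\<exists>V :: (real ^ 1) set. pos_lin_indep V \<and> card V = 2)"
proof -
  have "card {1, -1 :: real ^ 1} = 2"
    by (simp add: vec_eq_iff)
  then show ?thesis
    using pos_lin_indep_card_le_2 pos_lin_indep_1_minus_1 by blast
qed

end
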